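(* Let $\mathcal H$ be a Hilbert space and let $\{E_i\}$ be an error model on $\mathcal H$. Suppose $\mathcal C$ is a finite-dimensional subspace of $\mathcal H$ that is correctable for $\{E_i\}$, and that the error model is non-degenerate (with respect to $\mathcal C$). For each $i$, let $\mathcal V_i=\mathrm{Range}(E_i|_{\mathcal C})$ be the range subspace of the restriction of $E_i$ to $\mathcal C$. Then $\{\mathcal V_i\}$ is a set of isoclinic subspaces of $\mathcal H$.
   Context: Error model: a family $\{E_i\}$ of (bounded linear) operators on a Hilbert space $\mathcal H$ with $\sum_iE_i^*E_i\le I$; it is associated with the completely positive, trace non-increasing map $\mathcal E(\rho)=\sum_iE_i\rho E_i^*$. Correctable: a subspace (code) $\mathcal C$ of $\mathcal H$, with orthogonal projection $P_{\mathcal C}$ of $\mathcal H$ onto $\mathcal C$, is correctable for $\{E_i\}$ if (Knill--Laflamme conditions) there exist scalars $\alpha_{ij}\in\mathbb C$ such that $P_{\mathcal C}E_i^*E_jP_{\mathcal C}=\alpha_{ij}P_{\mathcal C}$ for all $i,j$. Non-degenerate: the set of restricted error operators $\{E_i|_{\mathcal C}\}$ is minimal in size, i.e. the operators $E_i|_{\mathcal C}$ are linearly independent (in particular none of them is zero). Canonical angles. Let $\mathcal V,\mathcal W$ be finite-dimensional subspaces of $\mathcal H$ and $l=\min\{\dim\mathcal V,\dim\mathcal W\}$. The canonical angles $\theta_1,\dots,\theta_l\in[0,\frac{\pi}{2}]$ between $\mathcal V$ and $\mathcal W$ are defined recursively: for $k=1,\dots,l$, $\theta_k$ is the unique number in $[0,\frac{\pi}{2}]$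 with $$\cos(\theta_k)=\max\{|\langle x,y\rangle| : x\in\mathcal V\cap\{x_1,\dots,x_{k-1}\}^\perp,\ y\in\mathcal W\cap\{y_1,\dots,y_{k-1}\}^\perp,\ \|x\|=\|y\|=1\},$$ where $x_j\in\mathcal V$, $y_j\in\mathcal W$ ($j<k$) are unit vectors chosen so that the $j$-th maximum is attained at $(x_j,y_j)$ (for $k=1$ there are no orthogonality constraints). Isoclinic subspaces. Two $m$-dimensional subspaces of $\mathcal H$ ($m\ge1$) are isoclinic if all $m$ canonical angles between them are equal. A collection of subspaces is isoclinic if all its members have the same dimension $m\geq 1$ and every pair of distinct subspaces from the collection is isoclinic. *)

theory Defs
  imports "HOL-Analysis.Analysis"
begin

class scaleC =
  fixes scaleC :: "complex \<Rightarrow> 'a \<Rightarrow> 'a" (infixr "*\<^sub>C" 75)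

class complex_vector = scaleC + real_vector +
  assumes scaleC_add_right: "a *\<^sub>C (x + y) = a *\<^sub>C x + a *\<^sub>C y"
    and scaleC_add_left: "(a + b) *\<^sub>C x = a *\<^sub>C x + b *\<^sub>C x"
    and scaleC_scaleC: "a *\<^sub>C (b *\<^sub>C x) = (a * b) *\<^sub>C x"
    and scaleC_one: "1 *\<^sub>C x = x"
    and scaleR_scaleC: "r *\<^sub>R x = complex_of_real r *\<^sub>C x"

text \<open>The inner product is conjugate-linear in the first argument and linear in the second.\<close>

class complex_inner = complex_vector + real_normed_vector +
  fixes cinner :: "'a \<Rightarrow> 'a \<Rightarrow> complex"
  assumes cinner_commute: "cinner x y = cnj (cinner y x)"
    and cinner_add_right: "cinner x (y + z) = cinner x y + cinner x z"
    and cinner_scaleC_right: "cinner x (a *\<^sub>C y) = a * cinner x y"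
    and cinner_ge_zero: "0 \<le> Re (cinner x x)"
    and cinner_eq_zero_iff: "cinner x x = 0 \<longleftrightarrow> x = 0"
    and norm_eq_sqrt_cinner: "norm x = sqrt (Re (cinner x x))"

class chilbert_space = complex_inner + complete_space

text \<open>Subspaces, spans and dimensions over the complex scalars are those of the library locale
  of vector spaces, under the prefix \<open>complex_vector\<close>.\<close>

global_interpretation complex_vector:
  vector_space "scaleC :: complex \<Rightarrow> 'a \<Rightarrow> 'a::complex_vector"
  by unfold_locales
    (simp_all add: scaleC_add_right scaleC_add_left scaleC_scaleC scaleC_one)

definition finite_dim_subspace :: "'a::complex_vector set \<Rightarrow> bool" where
  "finite_dim_subspace V \<longleftrightarrow>
     complex_vector.subspace V \<and> (\<exists>B. finite B \<and> complex_vector.span B = V)"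

definition bounded_clinear :: "('a::complex_inner \<Rightarrow> 'a) \<Rightarrow> bool" where
  "bounded_clinear A \<longleftrightarrow> bounded_linear A \<and> (\<forall>c x. A (c *\<^sub>C x) = c *\<^sub>C A x)"

text \<open>The adjoint exists for bounded complex-linear operators on a Hilbert space, by the Riesz
  representation theorem; it is only used for such operators.\<close>

definition cadjoint :: "('a::chilbert_space \<Rightarrow> 'a) \<Rightarrow> 'a \<Rightarrow> 'a" where
  "cadjoint A = (THE B. bounded_clinear B \<and> (\<forall>x y. cinner (B x) y = cinner x (A y)))"

text \<open>The orthogonal projection is only used for closed (here: finite-dimensional) subspaces.\<close>

definition orth_proj :: "'a::complex_inner set \<Rightarrow> 'a \<Rightarrow> 'a" where
  "orth_proj C x = (THE p. p \<in> C \<and> (\<forall>y\<in>C. cinner y (x - p) = 0))"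

definition operator_le :: "('a::complex_inner \<Rightarrow> 'a) \<Rightarrow> ('a \<Rightarrow> 'a) \<Rightarrow> bool" where
  "operator_le A B \<longleftrightarrow> (\<forall>x. cinner x (B x - A x) \<in> \<real> \<and> 0 \<le> Re (cinner x (B x - A x)))"

text \<open>The index set may be infinite; the sum of the operators \<open>E\<^sub>i\<^sup>* E\<^sub>i\<close> is then taken in the
  strong operator topology.\<close>

definition error_model :: "'i set \<Rightarrow> ('i \<Rightarrow> 'a::chilbert_space \<Rightarrow> 'a) \<Rightarrow> bool" where
  "error_model I E \<longleftrightarrow>
     (\<forall>i\<in>I. bounded_clinear (E i)) \<and>
     (\<forall>x. (\<lambda>i. cadjoint (E i) (E i x)) summable_on I) \<and>
     operator_le (\<lambda>x. \<Sum>\<^sub>\<infinity>i\<in>I. cadjoint (E i) (E i x)) (\<lambda>x. x)"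

definition correctable ::
  "'i set \<Rightarrow> ('i \<Rightarrow> 'a::chilbert_space \<Rightarrow> 'a) \<Rightarrow> 'a set \<Rightarrow> bool" where
  "correctable I E C \<longleftrightarrow>
     (\<exists>\<alpha> :: 'i \<Rightarrow> 'i \<Rightarrow> complex. \<forall>i\<in>I. \<forall>j\<in>I.
        orth_proj C \<circ> cadjoint (E i) \<circ> E j \<circ> orth_proj C = (\<lambda>x. \<alpha> i j *\<^sub>C orth_proj C x))"

text \<open>Linear independence of the family of restrictions of the \<open>E i\<close> to \<open>C\<close>.\<close>

definition nondegenerate ::
  "'i set \<Rightarrow> ('i \<Rightarrow> 'a::complex_vector \<Rightarrow> 'a) \<Rightarrow> 'a set \<Rightarrow> bool" where
  "nondegenerate I E C \<longleftrightarrow>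
     (\<forall>F (c :: 'i \<Rightarrow> complex). finite F \<longrightarrow> F \<subseteq> I \<longrightarrow>
        (\<forall>x\<in>C. (\<Sum>i\<in>F. c i *\<^sub>C E i x) = 0) \<longrightarrow> (\<forall>i\<in>F. c i = 0))"

definition unit_orth :: "'a::complex_inner set \<Rightarrow> (nat \<Rightarrow> 'a) \<Rightarrow> nat \<Rightarrow> 'a set" where
  "unit_orth V x k = {v \<in> V. norm v = 1 \<and> (\<forall>j\<in>{1..<k}. cinner (x j) v = 0)}"

text \<open>One run of the recursion defining the canonical angles: \<open>x k\<close> and \<open>y k\<close> attain the
  \<open>k\<close>-th maximum, whose value is \<open>cos (\<theta> k)\<close>. Indices start at \<open>1\<close>; values outside
  \<open>{1..l}\<close> are irrelevant.\<close>

definition canonical_system ::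
  "'a::complex_inner set \<Rightarrow> 'a set \<Rightarrow> (nat \<Rightarrow> real) \<Rightarrow> (nat \<Rightarrow> 'a) \<Rightarrow> (nat \<Rightarrow> 'a) \<Rightarrow> bool" where
  "canonical_system V W \<theta> x y \<longleftrightarrow>
     (\<forall>k\<in>{1..min (complex_vector.dim V) (complex_vector.dim W)}.
        \<theta> k \<in> {0..pi/2} \<and>
        x k \<in> unit_orth V x k \<and> y k \<in> unit_orth W y k \<and>
        cos (\<theta> k) = cmod (cinner (x k) (y k)) \<and>
        (\<forall>v\<in>unit_orth V x k. \<forall>w\<in>unit_orth W y k. cmod (cinner v w) \<le> cos (\<theta> k)))"

definition canonical_angles ::
  "'a::complex_inner set \<Rightarrow> 'a set \<Rightarrow> (nat \<Rightarrow> real) \<Rightarrow> bool" where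
  "canonical_angles V W \<theta> \<longleftrightarrow> (\<exists>x y. canonical_system V W \<theta> x y)"

text \<open>The canonical angles exist and do not depend on the chosen maximizers. Rather than building
  this into the definition, we ask that canonical angles exist and that, for every admissible
  choice of maximizers, they are all equal.\<close>

definition isoclinic :: "'a::complex_inner set \<Rightarrow> 'a set \<Rightarrow> bool" where
  "isoclinic V W \<longleftrightarrow>
     finite_dim_subspace V \<and> finite_dim_subspace W \<and>
     (\<exists>m\<ge>1. complex_vector.dim V = m \<and> complex_vector.dim W = m \<and>
        (\<exists>\<theta>. canonical_angles V W \<theta>) \<and>
        (\<forall>\<theta>. canonical_angles V W \<theta> \<longrightarrow> (\<forall>j\<in>{1..m}. \<forall>k\<in>{1..m}. \<theta> j = \<theta> k)))"

definition isoclinic_collection :: "'a::complex_inner set set \<Rightarrow> bool" where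
  "isoclinic_collection \<V> \<longleftrightarrow>
     (\<exists>m\<ge>1. \<forall>V\<in>\<V>. finite_dim_subspace V \<and> complex_vector.dim V = m) \<and>
     pairwise isoclinic \<V>"

end

theory Submission
  imports Defs
begin

text \<open>
  Restricting the Knill--Laflamme conditions to the code gives
  \<open>cinner (E i x) (E j y) = \<alpha> i j * cinner x y\<close> for \<open>x, y \<in> C\<close>
  (\<open>correctable_cinner\<close>).  For \<open>i = j\<close> this says that \<open>E i\<close> stretches all of \<open>C\<close> by the one
  factor \<open>sqrt (\<alpha> i i)\<close>, which is positive because a non-degenerate family contains no operator
  vanishing on \<open>C\<close>.  After division by these factors, any two of the ranges become images of \<open>C\<close>
  under linear isometries \<open>U\<close> and \<open>W\<close> with \<open>cinner (U x) (W y) = \<beta> * cinner x y\<close> for one scalar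
  \<open>\<beta>\<close>.

  For such a pair every canonical angle has cosine \<open>cmod \<beta>\<close>.  By Cauchy--Schwarz no pair of unit
  vectors exceeds this value, and \<open>(U v, W v)\<close> attains it for each unit vector \<open>v \<in> C\<close>.  What has
  to be excluded is that an unlucky choice of earlier maximizers \<open>U (c j)\<close>, \<open>W (d j)\<close> makes the two
  orthogonality constraints incompatible.  If \<open>\<beta> = 0\<close> this is harmless.  If \<open>\<beta> \<noteq> 0\<close>, attaining
  the maximum forces equality in Cauchy--Schwarz, so \<open>d j\<close> is a multiple of \<open>c j\<close>, and one unit
  vector \<open>v\<close> orthogonal to all earlier \<open>c j\<close> satisfies both sets of constraints.  Such a \<open>v\<close> exists
  as long as fewer than \<open>dim C\<close> vectors have been chosen.

  The correctability condition speaks of adjoints and orthogonal projections given by definite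
  descriptions, so their existence is established as well: adjoints through the Riesz
  representation theorem, projections onto finite-dimensional subspaces by Gram--Schmidt.
\<close>

section \<open>Complex inner products\<close>

abbreviation clinear :: "('a::complex_vector \<Rightarrow> 'b::complex_vector) \<Rightarrow> bool" where
  "clinear \<equiv> Vector_Spaces.linear scaleC scaleC"

lemma additive_cinner_right: "Modules.additive (cinner x)"
  by (rule Modules.additive.intro) (rule cinner_add_right)

lemmas cinner_zero_right [simp] = Modules.additive.zero [OF additive_cinner_right]
  and cinner_minus_right = Modules.additive.minus [OF additive_cinner_right]
  and cinner_diff_right = Modules.additive.diff [OF additive_cinner_right]

lemma cinner_add_left: "cinner (x + y) z = cinner x z + cinner y z"
  by (metis cinner_add_right cinner_commute complex_cnj_add)

lemma additive_cinner_left: "Modules.additive (\<lambda>x. cinner x z)"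
  by (rule Modules.additive.intro) (rule cinner_add_left)

lemmas cinner_zero_left [simp] = Modules.additive.zero [OF additive_cinner_left]
  and cinner_diff_left = Modules.additive.diff [OF additive_cinner_left]

lemma cinner_scaleC_left: "cinner (a *\<^sub>C x) y = cnj a * cinner x y"
  by (metis cinner_scaleC_right cinner_commute complex_cnj_mult)

lemma cinner_scaleR_right: "cinner x (r *\<^sub>R y) = of_real r * cinner x y"
  by (simp add: scaleR_scaleC cinner_scaleC_right)

lemma cinner_self: "cinner x x = of_real ((norm x)\<^sup>2)"
proof -
  have "Im (cinner x x) = 0"
    using arg_cong[OF cinner_commute[of x x], of Im] by simp
  then show ?thesis
    by (simp add: complex_eq_iff norm_eq_sqrt_cinner cinner_ge_zero)
qed

lemma cinner_eq_zero_sym: "cinner x y = 0 \<longleftrightarrow> cinner y x = 0"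
  by (metis cinner_commute complex_cnj_zero)

lemma cinner_ext:
  assumes "\<And>y. cinner u y = cinner v y"
  shows "u = v"
  using assms[of "u - v"] cinner_eq_zero_iff[of "u - v"] by (simp add: cinner_diff_left)

lemma norm_add_sq: "(norm (x + y))\<^sup>2 = (norm x)\<^sup>2 + (norm y)\<^sup>2 + 2 * Re (cinner x y)"
proof -
  have "Re (cinner y x) = Re (cinner x y)"
    using arg_cong[OF cinner_commute[of y x], of Re] by simp
  moreover have "Re (cinner (x + y) (x + y))
      = Re (cinner x x) + Re (cinner y y) + (Re (cinner x y) + Re (cinner y x))"
    by (simp add: cinner_add_left cinner_add_right)
  ultimately show ?thesis
    by (simp add: cinner_self)
qed

lemma parallelogram:
  fixes a b :: "'a::complex_inner"
  shows "(norm (a - b))\<^sup>2 + (norm (a + b))\<^sup>2 = 2 * (norm a)\<^sup>2 + 2 * (norm b)\<^sup>2"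
  using norm_add_sq[of a b] norm_add_sq[of a "- b"] by (simp add: cinner_minus_right)

text \<open>The left-hand side is the squared distance from \<open>y\<close> to the line through \<open>x\<close>; its being
  non-negative is Cauchy--Schwarz, its vanishing the case of equality.\<close>

lemma norm_residual_sq:
  assumes "norm x = 1"
  shows "(norm (y - cinner x y *\<^sub>C x))\<^sup>2 = (norm y)\<^sup>2 - (cmod (cinner x y))\<^sup>2"
proof -
  let ?a = "cinner x y" and ?r = "y - cinner x y *\<^sub>C x"
  have "cinner x x = 1" using assms by (simp add: cinner_self)
  then have "cinner x ?r = 0"
    by (simp add: cinner_diff_right cinner_scaleC_right)
  then have "cinner ?r ?r = cinner y ?r"
    by (simp add: cinner_diff_left cinner_scaleC_left)
  also have "\<dots> = cinner y y - ?a * cnj ?a"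
    by (simp add: cinner_diff_right cinner_scaleC_right) (metis cinner_commute)
  finally have "complex_of_real ((norm ?r)\<^sup>2) = of_real ((norm y)\<^sup>2 - (cmod ?a)\<^sup>2)"
    by (simp only: cinner_self complex_norm_square[symmetric] of_real_diff)
  then show ?thesis
    by (simp only: of_real_eq_iff)
qed

lemma cauchy_schwarz_unit:
  assumes "norm x = 1" and "norm y = 1"
  shows "cmod (cinner x y) \<le> 1"
proof -
  have "(cmod (cinner x y))\<^sup>2 \<le> 1\<^sup>2"
    using norm_residual_sq[OF assms(1), of y] assms(2) zero_le_power2[of "norm (y - cinner x y *\<^sub>C x)"]
    by simp
  then show ?thesis by (rule power2_le_imp_le) simp
qed

lemma cauchy_schwarz_unit_eq:
  assumes "norm x = 1" and "norm y = 1" and "cmod (cinner x y) = 1"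
  shows "y = cinner x y *\<^sub>C x"
  using norm_residual_sq[OF assms(1), of y] assms(2,3) by simp

lemma cauchy_schwarz: "cmod (cinner x y) \<le> norm x * norm y"
proof (cases "x = 0 \<or> y = 0")
  case False
  let ?u = "(1 / norm x) *\<^sub>R x" and ?v = "(1 / norm y) *\<^sub>R y"
  have "cmod (cinner ?u ?v) \<le> 1"
    using False by (intro cauchy_schwarz_unit) simp_all
  moreover have "cinner ?u ?v = of_real (1 / norm x) * of_real (1 / norm y) * cinner x y"
    by (simp add: scaleR_scaleC cinner_scaleC_right cinner_scaleC_left)
  ultimately show ?thesis
    using False by (simp add: norm_mult norm_divide field_simps)
qed auto

section \<open>The Riesz representation theorem and adjoints\<close>

text \<open>The representing vector is the minimizer of \<open>\<lambda>y. (norm y)\<^sup>2 - 2 * g y\<close>: the parallelogram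
  identity makes every minimizing sequence a Cauchy sequence, and the first variation at the
  minimizer vanishes.\<close>

lemma riesz_real:
  fixes g :: "'a::chilbert_space \<Rightarrow> real"
  assumes g: "bounded_linear g"
  shows "\<exists>u. \<forall>y. Re (cinner u y) = g y"
proof -
  interpret g: bounded_linear g by fact
  obtain K where K: "\<And>y. norm (g y) \<le> norm y * K"
    using g.bounded by blast
  define J where "J y = (norm y)\<^sup>2 - 2 * g y" for y
  have lower: "- K\<^sup>2 \<le> J y" for y
  proof -
    have "g y \<le> norm y * K" using K[of y] by simp
    moreover have "0 \<le> (norm y - K)\<^sup>2" by simp
    ultimately show ?thesis
      by (simp add: J_def power2_diff)
  qed
  then have bdd: "bdd_below (range J)"
    by (auto intro!: bdd_belowI)
  define d where "d = Inf (range J)"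
  have d: "d \<le> J y" for y
    unfolding d_def using bdd by (rule cInf_lower[rotated]) simp
  define r where "r n = 1 / real (Suc n)" for n
  have "\<exists>y. J y < d + r n" for n
  proof -
    have "Inf (range J) < d + r n"
      by (simp add: d_def r_def)
    then show ?thesis
      using cInf_lessD[of "range J"] by fastforce
  qed
  then obtain X where X: "\<And>n. J (X n) < d + r n"
    by metis
  have close: "(norm (a - b))\<^sup>2 \<le> 2 * (J a - d) + 2 * (J b - d)" for a b
  proof -
    have "J ((1/2) *\<^sub>R (a + b)) = (norm (a + b))\<^sup>2 / 4 - g a - g b"
      by (simp add: J_def g.scaleR g.add add_divide_distrib power2_eq_square)
    with d[of "(1/2) *\<^sub>R (a + b)"] parallelogram[of a b] show ?thesis
      by (simp add: J_def)
  qed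
  have "Cauchy X"
  proof (rule CauchyI)
    fix e :: real
    assume "0 < e"
    then obtain N where N: "r N < e\<^sup>2 / 4"
      using nat_approx_posE[of "e\<^sup>2 / 4"] by (auto simp: r_def)
    have "norm (X m - X n) < e" if "N \<le> m" "N \<le> n" for m n
    proof -
      have "r m \<le> r N" "r n \<le> r N"
        using that by (simp_all add: r_def frac_le)
      then have "2 * (J (X m) - d) + 2 * (J (X n) - d) \<le> 4 * r N"
        using X[of m] X[of n] by argo
      also have "\<dots> < e\<^sup>2"
        using N by simp
      finally have "(norm (X m - X n))\<^sup>2 < e\<^sup>2"
        by (rule le_less_trans[OF close])
      then show ?thesis
        using \<open>0 < e\<close> by (simp add: power2_less_imp_less)
    qed
    then show "\<exists>M. \<forall>m\<ge>M. \<forall>n\<ge>M. norm (X m - X n) < e" by blast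
  qed
  then obtain u where u: "X \<longlonglongrightarrow> u"
    using Cauchy_convergent convergent_def by blast
  have "(\<lambda>n. J (X n)) \<longlonglongrightarrow> J u"
    unfolding J_def by (intro tendsto_intros g.tendsto u)
  moreover have "(\<lambda>n. d + r n) \<longlonglongrightarrow> d"
    using tendsto_add[OF tendsto_const[of d] LIMSEQ_inverse_real_of_nat] by (simp add: r_def inverse_eq_divide)
  ultimately have Ju: "J u \<le> d"
    by (rule LIMSEQ_le) (use X less_imp_le in blast)
  have "Re (cinner u y) = g y" for y
  proof -
    define b where "b = Re (cinner u y) - g y"
    define q where "q = (norm y)\<^sup>2"
    have var: "0 \<le> t\<^sup>2 * q + 2 * t * b" for t
    proof -
      have "J (u + t *\<^sub>R y) = J u + t\<^sup>2 * q + 2 * t * b"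
        by (simp add: J_def norm_add_sq cinner_scaleR_right g.add g.scaleR b_def q_def
            power_mult_distrib algebra_simps)
      with d[of "u + t *\<^sub>R y"] Ju show ?thesis by linarith
    qed
    have "0 \<le> q" by (simp add: q_def)
    \<comment> \<open>At this \<open>t\<close> the quadratic is negative unless \<open>b = 0\<close>; the summand 1 covers \<open>q = 0\<close>.\<close>
    define t where "t = - b / (q + 1)"
    have b: "b = - t * (q + 1)"
      using \<open>0 \<le> q\<close> by (simp add: t_def)
    have "t\<^sup>2 * q + 2 * t * b = - (t\<^sup>2 * (q + 2))"
      by (simp add: b algebra_simps power2_eq_square)
    with var[of t] have "t\<^sup>2 * (q + 2) \<le> 0"
      by simp
    then have "b = 0"
      using \<open>0 \<le> q\<close> by (auto simp: b mult_le_0_iff)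
    then show ?thesis by (simp add: b_def)
  qed
  then show ?thesis by blast
qed

text \<open>A complex-linear functional is determined by its real part, since the imaginary part at \<open>y\<close>
  is minus the real part at \<open>\<i> *\<^sub>C y\<close>.\<close>

lemma riesz:
  fixes f :: "'a::chilbert_space \<Rightarrow> complex"
  assumes f: "bounded_linear f" and fC: "\<And>c y. f (c *\<^sub>C y) = c * f y"
  shows "\<exists>u. \<forall>y. cinner u y = f y"
proof -
  have "bounded_linear (\<lambda>y. Re (f y))"
    using bounded_linear_compose[OF bounded_linear_Re f] .
  then obtain u where u: "\<And>y. Re (cinner u y) = Re (f y)"
    using riesz_real by blast
  have "Im (cinner u y) = Im (f y)" for y
    using u[of "\<i> *\<^sub>C y"] by (simp add: cinner_scaleC_right fC)
  with u have "cinner u y = f y" for y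
    by (simp add: complex_eq_iff)
  then show ?thesis by blast
qed

lemma bounded_linear_cinner_comp:
  assumes "bounded_linear A"
  shows "bounded_linear (\<lambda>y. cinner x (A y))"
proof -
  interpret A: bounded_linear A by fact
  obtain K where K: "\<And>y. norm (A y) \<le> norm y * K"
    using A.bounded by blast
  show ?thesis
  proof (rule bounded_linear_intro)
    fix y z and r :: real
    show "cinner x (A (y + z)) = cinner x (A y) + cinner x (A z)"
      by (simp add: A.add cinner_add_right)
    show "cinner x (A (r *\<^sub>R y)) = r *\<^sub>R cinner x (A y)"
      by (simp add: A.scaleR cinner_scaleR_right scaleR_conv_of_real)
    have "cmod (cinner x (A y)) \<le> norm x * norm (A y)"
      by (rule cauchy_schwarz)
    also have "\<dots> \<le> norm x * (norm y * K)"
      by (intro mult_left_mono K) simp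
    finally show "norm (cinner x (A y)) \<le> norm y * (norm x * K)"
      by (simp add: algebra_simps)
  qed
qed

lemma cadjoint_exists:
  fixes A :: "'a::chilbert_space \<Rightarrow> 'a"
  assumes "bounded_clinear A"
  shows "\<exists>B. bounded_clinear B \<and> (\<forall>x y. cinner (B x) y = cinner x (A y))"
proof -
  have A: "bounded_linear A" and AC: "\<And>c x. A (c *\<^sub>C x) = c *\<^sub>C A x"
    using assms by (auto simp: bounded_clinear_def)
  have "\<exists>u. \<forall>y. cinner u y = cinner x (A y)" for x
    by (rule riesz) (simp_all add: bounded_linear_cinner_comp A AC cinner_scaleC_right)
  then obtain B where B: "\<And>x y. cinner (B x) y = cinner x (A y)"
    by metis
  have add: "B (x + y) = B x + B y" for x y
    by (rule cinner_ext) (simp add: B cinner_add_left)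
  have scale: "B (c *\<^sub>C x) = c *\<^sub>C B x" for c x
    by (rule cinner_ext) (simp add: B cinner_scaleC_left)
  obtain K where K: "\<And>y. norm (A y) \<le> norm y * K"
    using bounded_linear.bounded[OF A] by blast
  have bound: "norm (B x) \<le> norm x * \<bar>K\<bar>" for x
  proof (cases "B x = 0")
    case False
    have "(norm (B x))\<^sup>2 = cmod (cinner (B x) (B x))"
      by (simp only: cinner_self norm_of_real) simp
    also have "\<dots> \<le> norm x * norm (A (B x))"
      unfolding B by (rule cauchy_schwarz)
    also have "\<dots> \<le> norm x * (norm (B x) * \<bar>K\<bar>)"
      using K[of "B x"] by (intro mult_left_mono order_trans[OF K] mult_left_mono) auto
    finally have "norm (B x) * norm (B x) \<le> norm (B x) * (norm x * \<bar>K\<bar>)"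
      by (simp add: power2_eq_square algebra_simps)
    then show ?thesis
      using False by simp
  qed simp
  have "bounded_linear B"
    by (rule bounded_linear_intro[where K = "\<bar>K\<bar>"]) (simp_all add: add bound scaleR_scaleC scale)
  then show ?thesis
    using B scale by (auto simp: bounded_clinear_def)
qed

lemma cadjoint_cinner:
  fixes A :: "'a::chilbert_space \<Rightarrow> 'a"
  assumes "bounded_clinear A"
  shows "cinner (cadjoint A x) y = cinner x (A y)"
proof -
  have "\<exists>!B. bounded_clinear B \<and> (\<forall>x y. cinner (B x) y = cinner x (A y))"
    using cadjoint_exists[OF assms] by (metis cinner_ext ext)
  from theI'[OF this] show ?thesis
    unfolding cadjoint_def by blast
qed

section \<open>Projections and orthonormal systems in finite-dimensional subspaces\<close>

text \<open>The Gram--Schmidt step: enlarging \<open>S\<close> by \<open>a\<close> adds to the projection the component along the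
  part \<open>a'\<close> of \<open>a\<close> orthogonal to \<open>S\<close>.\<close>

lemma projection_onto_span_exists:
  assumes "finite S"
  shows "\<exists>p\<in>complex_vector.span S. \<forall>s\<in>S. cinner s (x - p) = 0"
  using assms
proof (induction S arbitrary: x rule: finite_induct)
  case (insert a S)
  let ?sp = "complex_vector.span (insert a S)"
  have sub: "complex_vector.span S \<subseteq> ?sp"
    by (rule complex_vector.span_mono) auto
  obtain p where p: "p \<in> complex_vector.span S" "\<forall>s\<in>S. cinner s (x - p) = 0"
    using insert.IH by blast
  obtain q where q: "q \<in> complex_vector.span S" "\<forall>s\<in>S. cinner s (a - q) = 0"
    using insert.IH by blast
  define a' where "a' = a - q"
  \<comment> \<open>When \<open>a' = 0\<close> the quotient is \<open>0\<close> by convention, and \<open>p\<close> itself is the projection.\<close>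
  define t where "t = cinner a' (x - p) / cinner a' a'"
  have orth_q: "cinner z q = 0" if z: "\<forall>s\<in>S. cinner s z = 0" for z
  proof -
    have "complex_vector.subspace {w. cinner z w = 0}"
      by (auto simp: complex_vector.subspace_def cinner_add_right cinner_scaleC_right)
    moreover have "S \<subseteq> {w. cinner z w = 0}"
      using z cinner_eq_zero_sym by blast
    ultimately show ?thesis
      using complex_vector.span_minimal q(1) by blast
  qed
  have S: "\<forall>s\<in>S. cinner s (x - (p + t *\<^sub>C a')) = 0"
    using p(2) q(2) by (simp add: a'_def cinner_diff_right cinner_add_right cinner_scaleC_right)
  have "cinner a' (x - (p + t *\<^sub>C a')) = cinner a' (x - p) - t * cinner a' a'"
    by (simp add: cinner_diff_right cinner_add_right cinner_scaleC_right)
  also have "\<dots> = 0"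
    by (cases "a' = 0") (simp_all add: t_def cinner_eq_zero_iff)
  finally have "cinner a' (x - (p + t *\<^sub>C a')) = 0" .
  moreover have "cinner q (x - (p + t *\<^sub>C a')) = 0"
    using orth_q[OF S] cinner_eq_zero_sym by blast
  ultimately have "cinner a (x - (p + t *\<^sub>C a')) = 0"
    using cinner_add_left[of a' q "x - (p + t *\<^sub>C a')"] by (simp add: a'_def)
  moreover have "p + t *\<^sub>C a' \<in> ?sp"
    unfolding a'_def using p(1) q(1) sub
    by (intro complex_vector.span_add complex_vector.span_scale complex_vector.span_diff)
      (auto intro: complex_vector.span_base)
  ultimately show ?case
    using S by blast
qed simp

lemma orth_proj_props:
  assumes "finite_dim_subspace C"
  shows "orth_proj C x \<in> C" and "\<And>y. y \<in> C \<Longrightarrow> cinner y (x - orth_proj C x) = 0"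
proof -
  obtain S where S: "finite S" "complex_vector.span S = C" and C: "complex_vector.subspace C"
    using assms by (auto simp: finite_dim_subspace_def)
  obtain p where p: "p \<in> C" "\<forall>s\<in>S. cinner s (x - p) = 0"
    using projection_onto_span_exists[OF S(1), of x] S(2) by blast
  have orth: "cinner y (x - p) = 0" if "y \<in> C" for y
  proof -
    have "complex_vector.subspace {w. cinner w (x - p) = 0}"
      by (auto simp: complex_vector.subspace_def cinner_add_left cinner_scaleC_left)
    moreover have "S \<subseteq> {w. cinner w (x - p) = 0}"
      using p(2) by blast
    ultimately show ?thesis
      using complex_vector.span_minimal S(2) that by blast
  qed
  have "p' = p" if "p' \<in> C" "\<forall>y\<in>C. cinner y (x - p') = 0" for p'
  proof -
    have "p' - p \<in> C"
      using that(1) p(1) C by (rule complex_vector.subspace_diff[rotated])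
    then have "cinner (p' - p) (x - p) - cinner (p' - p) (x - p') = 0"
      using orth that(2) by simp
    then have "cinner (p' - p) (p' - p) = 0"
      by (simp add: cinner_diff_right)
    then show ?thesis by (simp add: cinner_eq_zero_iff)
  qed
  with p(1) orth have "\<exists>!p. p \<in> C \<and> (\<forall>y\<in>C. cinner y (x - p) = 0)"
    by blast
  from theI'[OF this] show "orth_proj C x \<in> C" "\<And>y. y \<in> C \<Longrightarrow> cinner y (x - orth_proj C x) = 0"
    unfolding orth_proj_def by blast+
qed

lemma orth_proj_id:
  assumes "finite_dim_subspace C" and "x \<in> C"
  shows "orth_proj C x = x"
proof -
  have "x - orth_proj C x \<in> C"
    using assms orth_proj_props(1) complex_vector.subspace_diff
    by (metis finite_dim_subspace_def)
  then have "cinner (x - orth_proj C x) (x - orth_proj C x) = 0"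
    using orth_proj_props(2)[OF assms(1)] by blast
  then show ?thesis by (simp add: cinner_eq_zero_iff)
qed

lemma cinner_orth_proj:
  assumes "finite_dim_subspace C" and "x \<in> C"
  shows "cinner x (orth_proj C z) = cinner x z"
  using orth_proj_props(2)[OF assms, of z] by (simp add: cinner_diff_right)

text \<open>Fewer than \<open>dim C\<close> vectors do not span \<open>C\<close>, and a vector outside their span has a non-zero
  component orthogonal to all of them.\<close>

lemma unit_vector_orthogonal_to_few:
  assumes C: "complex_vector.subspace C" and S: "finite S" "S \<subseteq> C"
    and card: "card S < complex_vector.dim C"
  shows "\<exists>v\<in>C. norm v = 1 \<and> (\<forall>s\<in>S. cinner s v = 0)"
proof -
  have "\<not> C \<subseteq> complex_vector.span S"
    using complex_vector.dim_le_card[of C S] S(1) card by linarith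
  then obtain x where x: "x \<in> C" "x \<notin> complex_vector.span S" by blast
  obtain p where p: "p \<in> complex_vector.span S" "\<forall>s\<in>S. cinner s (x - p) = 0"
    using projection_onto_span_exists[OF S(1), of x] by blast
  have "p \<in> C"
    using p(1) complex_vector.span_minimal[OF S(2) C] by blast
  let ?v = "(1 / norm (x - p)) *\<^sub>R (x - p)"
  have "?v \<in> C"
    using complex_vector.subspace_scale[OF C] complex_vector.subspace_diff[OF C x(1) \<open>p \<in> C\<close>]
    by (simp add: scaleR_scaleC)
  moreover have "norm ?v = 1"
    using x(2) p(1) by auto
  moreover have "\<forall>s\<in>S. cinner s ?v = 0"
    using p(2) by (simp add: cinner_scaleR_right)
  ultimately show ?thesis by blast
qed

lemma unit_orth_nonempty:
  assumes C: "complex_vector.subspace C" and x: "\<forall>j\<in>{1..<k}. x j \<in> C"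
    and k: "1 \<le> k" "k \<le> complex_vector.dim C"
  shows "\<exists>v. v \<in> unit_orth C x k"
proof -
  have "card (x ` {1..<k}) \<le> k - 1"
    using card_image_le[of "{1..<k}" x] by simp
  then have "card (x ` {1..<k}) < complex_vector.dim C"
    using k by linarith
  then show ?thesis
    using unit_vector_orthogonal_to_few[OF C, of "x ` {1..<k}"] x by (auto simp: unit_orth_def)
qed

lemma orthonormal_system_exists:
  assumes C: "complex_vector.subspace C" and n: "n \<le> complex_vector.dim C"
  shows "\<exists>e. \<forall>k\<in>{1..n}. e k \<in> unit_orth C e k"
  using n
proof (induction n)
  case (Suc n)
  then obtain e where e: "\<forall>k\<in>{1..n}. e k \<in> unit_orth C e k" by auto
  then obtain v where v: "v \<in> unit_orth C e (Suc n)"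
    using unit_orth_nonempty[OF C, of "Suc n" e] Suc.prems by (force simp: unit_orth_def)
  have "unit_orth C (e(Suc n := v)) k = unit_orth C e k" if "k \<le> Suc n" for k
    using that by (simp add: unit_orth_def)
  then have "\<forall>k\<in>{1..Suc n}. (e(Suc n := v)) k \<in> unit_orth C (e(Suc n := v)) k"
    using e v by (auto simp: le_Suc_eq)
  then show ?case by blast
qed simp

lemma injective_image_finite_dim:
  assumes C: "finite_dim_subspace C" and U: "clinear U" and inj: "inj_on U C"
  shows "finite_dim_subspace (U ` C) \<and> complex_vector.dim (U ` C) = complex_vector.dim C"
proof -
  interpret U: Vector_Spaces.linear scaleC scaleC U by (rule U)
  obtain S where S: "finite S" "complex_vector.span S = C" and sub: "complex_vector.subspace C"
    using C by (auto simp: finite_dim_subspace_def)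
  obtain B where B: "B \<subseteq> C" "complex_vector.independent B" "C \<subseteq> complex_vector.span B"
    and card: "card B = complex_vector.dim C"
    using complex_vector.basis_exists by blast
  have span: "complex_vector.span B = C"
    using B complex_vector.span_minimal[OF B(1) sub] by blast
  have "complex_vector.independent (U ` B)"
    using U.independent_injective_image B(2) inj span by simp
  moreover have "complex_vector.span (U ` B) = U ` C"
    using U.span_image[of B] span by simp
  ultimately have "complex_vector.dim (U ` C) = card (U ` B)"
    using complex_vector.dim_span_eq_card_independent[of "U ` B"] by simp
  also have "\<dots> = card B"
    using inj B(1) by (intro card_image) (rule inj_on_subset)
  finally have "complex_vector.dim (U ` C) = complex_vector.dim C"
    using card by simp
  moreover have "finite (U ` S)" "complex_vector.span (U ` S) = U ` C"
    using S U.span_image[of S] by simp_all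
  ultimately show ?thesis
    unfolding finite_dim_subspace_def by (metis complex_vector.subspace_span)
qed

section \<open>Canonical angles between proportional isometric images\<close>

text \<open>This is the situation of two error operators on a correctable code, each divided by its
  stretching factor.  In terms of \<open>T = W \<circ> U\<^sup>-\<^sup>1\<close> it says that the two images are related by a unitary
  map \<open>T\<close> whose compression to the first image is the scalar \<open>\<beta>\<close>.\<close>

locale proportional_isometries =
  fixes C :: "'a::complex_inner set" and U W :: "'a \<Rightarrow> 'a" and \<beta> :: complex
  assumes C: "finite_dim_subspace C" and dim_pos: "1 \<le> complex_vector.dim C"
    and U: "clinear U" and W: "clinear W"
    and UU: "x \<in> C \<Longrightarrow> y \<in> C \<Longrightarrow> cinner (U x) (U y) = cinner x y"
    and WW: "x \<in> C \<Longrightarrow> y \<in> C \<Longrightarrow> cinner (W x) (W y) = cinner x y"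
    and UW: "x \<in> C \<Longrightarrow> y \<in> C \<Longrightarrow> cinner (U x) (W y) = \<beta> * cinner x y"
begin

lemma subspace: "complex_vector.subspace C"
  using C by (simp add: finite_dim_subspace_def)

lemma isometry_image:
  assumes T: "clinear T" and TT: "\<And>x y. x \<in> C \<Longrightarrow> y \<in> C \<Longrightarrow> cinner (T x) (T y) = cinner x y"
  shows "finite_dim_subspace (T ` C)" and "complex_vector.dim (T ` C) = complex_vector.dim C"
proof -
  interpret T: Vector_Spaces.linear scaleC scaleC T by (rule T)
  have "inj_on T C"
  proof (rule inj_onI)
    fix x y assume xy: "x \<in> C" "y \<in> C" "T x = T y"
    then have "x - y \<in> C" by (intro complex_vector.subspace_diff subspace)
    then have "cinner (x - y) (x - y) = cinner (T (x - y)) (T (x - y))"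
      by (simp add: TT)
    also have "\<dots> = 0" using xy by (simp add: T.diff)
    finally show "x = y" by (simp add: cinner_eq_zero_iff)
  qed
  from injective_image_finite_dim[OF C T this]
  show "finite_dim_subspace (T ` C)" "complex_vector.dim (T ` C) = complex_vector.dim C"
    by auto
qed

lemma norm_U: "x \<in> C \<Longrightarrow> norm (U x) = norm x"
  and norm_W: "x \<in> C \<Longrightarrow> norm (W x) = norm x"
  using UU[of x x] WW[of x x] by (simp_all add: norm_eq_sqrt_cinner)

lemma dim_U: "complex_vector.dim (U ` C) = complex_vector.dim C"
  and dim_W: "complex_vector.dim (W ` C) = complex_vector.dim C"
  and finite_dim_U: "finite_dim_subspace (U ` C)"
  and finite_dim_W: "finite_dim_subspace (W ` C)"
  using isometry_image[OF U UU] isometry_image[OF W WW] by blast+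

lemma cmod_cinner_le:
  assumes "x \<in> C" "y \<in> C" "norm x = 1" "norm y = 1"
  shows "cmod (cinner (U x) (W y)) \<le> cmod \<beta>"
  using cauchy_schwarz_unit[OF assms(3,4)]
  by (simp add: UW[OF assms(1,2)] norm_mult mult_left_le)

lemma cmod_beta_le_1: "cmod \<beta> \<le> 1"
proof -
  obtain v where v: "v \<in> C" "norm v = 1"
    using unit_vector_orthogonal_to_few[OF subspace, of "{}"] dim_pos by auto
  then have "cmod (cinner (U v) (W v)) \<le> 1"
    by (intro cauchy_schwarz_unit) (simp_all add: norm_U norm_W)
  then show ?thesis
    using v by (simp add: UW cinner_self)
qed

text \<open>The images under \<open>U\<close> and \<open>W\<close> of one orthonormal basis of \<open>C\<close> are maximizers.\<close>

lemma canonical_angles_exist: "canonical_angles (U ` C) (W ` C) (\<lambda>_. arccos (cmod \<beta>))"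
proof -
  obtain e where e: "\<And>k. k \<in> {1..complex_vector.dim C} \<Longrightarrow> e k \<in> unit_orth C e k"
    using orthonormal_system_exists[OF subspace, of "complex_vector.dim C"] by blast
  then have eC: "\<And>k. k \<in> {1..complex_vector.dim C} \<Longrightarrow> e k \<in> C \<and> norm (e k) = 1"
    by (simp add: unit_orth_def)
  have cos: "cos (arccos (cmod \<beta>)) = cmod \<beta>"
    by (intro cos_arccos order_trans[OF _ norm_ge_zero] cmod_beta_le_1) simp
  have "- 1 \<le> cmod \<beta>"
    by (rule order_trans[OF _ norm_ge_zero]) simp
  then have range: "arccos (cmod \<beta>) \<in> {0..pi/2}"
    using arccos_lbound[of "cmod \<beta>"] arccos_le_pi2[of "cmod \<beta>"] cmod_beta_le_1 by simp
  have "canonical_system (U ` C) (W ` C) (\<lambda>_. arccos (cmod \<beta>)) (\<lambda>k. U (e k)) (\<lambda>k. W (e k))"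
    unfolding canonical_system_def cos
  proof (intro ballI conjI range)
    fix k assume "k \<in> {1..min (complex_vector.dim (U ` C)) (complex_vector.dim (W ` C))}"
    then have k: "k \<in> {1..complex_vector.dim C}"
      by (simp add: dim_U dim_W)
    have "\<forall>j\<in>{1..<k}. e j \<in> C \<and> cinner (e j) (e k) = 0"
      using e[OF k] eC k by (auto simp: unit_orth_def)
    then show "U (e k) \<in> unit_orth (U ` C) (\<lambda>k. U (e k)) k"
      "W (e k) \<in> unit_orth (W ` C) (\<lambda>k. W (e k)) k"
      using eC[OF k] by (auto simp: unit_orth_def norm_U norm_W UU WW)
    show "cmod \<beta> = cmod (cinner (U (e k)) (W (e k)))"
      using eC[OF k] by (simp add: UW cinner_self)
    fix v w
    assume "v \<in> unit_orth (U ` C) (\<lambda>k. U (e k)) k" "w \<in> unit_orth (W ` C) (\<lambda>k. W (e k)) k"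
    then obtain a b where "v = U a" "w = W b" "a \<in> C" "b \<in> C" "norm (U a) = 1" "norm (W b) = 1"
      by (auto simp: unit_orth_def)
    then show "cmod (cinner v w) \<le> cmod \<beta>"
      using cmod_cinner_le by (simp add: norm_U norm_W)
  qed
  then show ?thesis
    unfolding canonical_angles_def by blast
qed

text \<open>By strong induction on \<open>k\<close>: if all earlier maxima equal \<open>cmod \<beta> \<noteq> 0\<close>, the earlier
  maximizers come from parallel vectors of \<open>C\<close>, so a single \<open>v \<in> C\<close> meets both sets of constraints
  at step \<open>k\<close> and \<open>(U v, W v)\<close> attains \<open>cmod \<beta>\<close> again.\<close>

lemma canonical_system_cos:
  assumes sys: "canonical_system (U ` C) (W ` C) \<theta> x y" and "k \<in> {1..complex_vector.dim C}"
  shows "cos (\<theta> k) = cmod \<beta>"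
proof -
  let ?m = "complex_vector.dim C"
  have sys':
    "x k \<in> unit_orth (U ` C) x k" "y k \<in> unit_orth (W ` C) y k"
    "cos (\<theta> k) = cmod (cinner (x k) (y k))"
    "\<And>v w. v \<in> unit_orth (U ` C) x k \<Longrightarrow> w \<in> unit_orth (W ` C) y k \<Longrightarrow> cmod (cinner v w) \<le> cos (\<theta> k)"
    if "k \<in> {1..?m}" for k
    using sys that unfolding canonical_system_def dim_U dim_W min.idem by blast+
  have "\<exists>a. a \<in> C \<and> norm a = 1 \<and> x k = U a" "\<exists>b. b \<in> C \<and> norm b = 1 \<and> y k = W b"
    if "k \<in> {1..?m}" for k
    using sys'(1,2)[OF that] by (auto simp: unit_orth_def norm_U norm_W)
  then obtain c d
    where c: "\<And>k. k \<in> {1..?m} \<Longrightarrow> c k \<in> C \<and> norm (c k) = 1 \<and> x k = U (c k)"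
      and d: "\<And>k. k \<in> {1..?m} \<Longrightarrow> d k \<in> C \<and> norm (d k) = 1 \<and> y k = W (d k)"
    by metis
  show ?thesis
    using assms(2)
  proof (induction k rule: less_induct)
    case (less k)
    have le: "cos (\<theta> k) \<le> cmod \<beta>"
      using sys'(3)[OF less.prems] c[OF less.prems] d[OF less.prems] cmod_cinner_le by simp
    show ?case
    proof (cases "\<beta> = 0")
      case True
      then show ?thesis using le sys'(3)[OF less.prems] by simp
    next
      case False
      have in_range: "j \<in> {1..?m}" if "j \<in> {1..<k}" for j
        using that less.prems by auto
      have parallel: "d j = cinner (c j) (d j) *\<^sub>C c j" if j: "j \<in> {1..<k}" for j
      proof (rule cauchy_schwarz_unit_eq)
        have "cmod \<beta> = cmod (cinner (x j) (y j))"
          using less.IH[of j] j in_range[OF j] sys'(3)[OF in_range[OF j]] by simp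
        also have "\<dots> = cmod \<beta> * cmod (cinner (c j) (d j))"
          using c[OF in_range[OF j]] d[OF in_range[OF j]] by (simp add: UW norm_mult)
        finally show "cmod (cinner (c j) (d j)) = 1"
          using False by simp
      qed (use c[OF in_range[OF j]] d[OF in_range[OF j]] in auto)
      obtain v where v: "v \<in> unit_orth C c k"
        using unit_orth_nonempty[OF subspace, of k c] c in_range less.prems by auto
      then have vC: "v \<in> C" "norm v = 1" and cv: "\<And>j. j \<in> {1..<k} \<Longrightarrow> cinner (c j) v = 0"
        by (auto simp: unit_orth_def)
      have dv: "cinner (d j) v = 0" if "j \<in> {1..<k}" for j
        using cv[OF that] by (subst parallel[OF that]) (simp add: cinner_scaleC_left)
      have "U v \<in> unit_orth (U ` C) x k"
        using vC cv c in_range by (auto simp: unit_orth_def norm_U UU)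
      moreover have "W v \<in> unit_orth (W ` C) y k"
        using vC dv d in_range by (auto simp: unit_orth_def norm_W WW)
      ultimately have "cmod (cinner (U v) (W v)) \<le> cos (\<theta> k)"
        by (rule sys'(4)[OF less.prems])
      then have "cmod \<beta> \<le> cos (\<theta> k)"
        using vC by (simp add: UW cinner_self)
      with le show ?thesis by simp
    qed
  qed
qed

lemma isoclinic_images: "isoclinic (U ` C) (W ` C)"
proof -
  let ?m = "complex_vector.dim C"
  have "\<theta> j = \<theta> k"
    if "canonical_angles (U ` C) (W ` C) \<theta>" and jk: "j \<in> {1..?m}" "k \<in> {1..?m}" for \<theta> j k
  proof -
    obtain x y where sys: "canonical_system (U ` C) (W ` C) \<theta> x y"
      using \<open>canonical_angles (U ` C) (W ` C) \<theta>\<close> by (auto simp: canonical_angles_def)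
    have "\<theta> i \<in> {0..pi/2}" if "i \<in> {1..?m}" for i
      using sys that by (simp add: canonical_system_def dim_U dim_W)
    from this[OF jk(1)] this[OF jk(2)]
    have "0 \<le> \<theta> j" "\<theta> j \<le> pi" "0 \<le> \<theta> k" "\<theta> k \<le> pi"
      by auto
    then show ?thesis
      using canonical_system_cos[OF sys jk(1)] canonical_system_cos[OF sys jk(2)]
      by (metis cos_inj_pi)
  qed
  then show ?thesis
    unfolding isoclinic_def
    using finite_dim_U finite_dim_W dim_U dim_W dim_pos canonical_angles_exist by blast
qed

end

section \<open>Correctable codes\<close>

lemma bounded_clinear_imp_clinear: "bounded_clinear A \<Longrightarrow> clinear A"
  using bounded_linear.linear[THEN linear_add]
  by (auto simp: bounded_clinear_def Vector_Spaces.linear_iff complex_vector.vector_space_axioms)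

text \<open>Inner products with vectors of \<open>C\<close> do not see the outer projection, the inner projection fixes
  \<open>C\<close>, and the adjoint moves to the other side.\<close>

lemma correctable_cinner:
  assumes E: "\<And>i. i \<in> I \<Longrightarrow> bounded_clinear (E i)" and C: "finite_dim_subspace C"
    and "correctable I E C"
  obtains \<alpha> where "\<And>i j x y. i \<in> I \<Longrightarrow> j \<in> I \<Longrightarrow> x \<in> C \<Longrightarrow> y \<in> C \<Longrightarrow>
    cinner (E i x) (E j y) = \<alpha> i j * cinner x y"
proof -
  obtain \<alpha> :: "'a \<Rightarrow> 'a \<Rightarrow> complex" where \<alpha>: "\<And>i j. i \<in> I \<Longrightarrow> j \<in> I \<Longrightarrow>
      orth_proj C \<circ> cadjoint (E i) \<circ> E j \<circ> orth_proj C = (\<lambda>x. \<alpha> i j *\<^sub>C orth_proj C x)"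
    using assms(3) by (auto simp: correctable_def)
  have "cinner (E i x) (E j y) = \<alpha> i j * cinner x y"
    if ij: "i \<in> I" "j \<in> I" and xy: "x \<in> C" "y \<in> C" for i j x y
  proof -
    have "orth_proj C (cadjoint (E i) (E j y)) = \<alpha> i j *\<^sub>C y"
      using fun_cong[OF \<alpha>[OF ij], of y] by (simp add: orth_proj_id[OF C xy(2)])
    then have "\<alpha> i j * cinner x y = cinner x (cadjoint (E i) (E j y))"
      by (metis cinner_orth_proj[OF C xy(1)] cinner_scaleC_right)
    also have "\<dots> = cinner (E i x) (E j y)"
      using cadjoint_cinner[OF E[OF ij(1)], of "E j y" x] by (metis cinner_commute)
    finally show ?thesis by simp
  qed
  then show thesis using that by blast
qed

theorem theorem6:
  fixes I :: "'i set"
    and E :: "'i \<Rightarrow> 'h::chilbert_space \<Rightarrow> 'h"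
    and C :: "'h set"
  assumes "error_model I E"
    and "finite_dim_subspace C"
    and "correctable I E C"
    and "nondegenerate I E C"
  shows "isoclinic_collection {E i ` C |i. i \<in> I}"
proof -
  note C = assms(2)
  have sub: "complex_vector.subspace C"
    using C by (simp add: finite_dim_subspace_def)
  have E: "\<And>i. i \<in> I \<Longrightarrow> bounded_clinear (E i)"
    using assms(1) by (simp add: error_model_def)
  obtain \<alpha> where \<alpha>: "\<And>i j x y. i \<in> I \<Longrightarrow> j \<in> I \<Longrightarrow> x \<in> C \<Longrightarrow> y \<in> C \<Longrightarrow>
      cinner (E i x) (E j y) = \<alpha> i j * cinner x y"
    using correctable_cinner[OF E C assms(3)] by blast
  have nonzero: "\<exists>x\<in>C. E i x \<noteq> 0" if "i \<in> I" for i
    using assms(4)[unfolded nondegenerate_def, rule_format, of "{i}" "\<lambda>_. 1" i] that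
    by (auto simp: scaleC_one)
  have dim_pos: "1 \<le> complex_vector.dim C" if i: "i \<in> I" for i
  proof -
    obtain x where x: "x \<in> C" "E i x \<noteq> 0" using nonzero[OF i] by blast
    interpret Ei: Vector_Spaces.linear scaleC scaleC "E i"
      using bounded_clinear_imp_clinear[OF E[OF that]] .
    have "x \<noteq> 0" using x(2) Ei.zero by metis
    obtain B where B: "B \<subseteq> C" "complex_vector.independent B" "C \<subseteq> complex_vector.span B"
      "card B = complex_vector.dim C"
      using complex_vector.basis_exists by blast
    obtain S where "finite S" "complex_vector.span S = C"
      using C by (auto simp: finite_dim_subspace_def)
    then have "finite B"
      using complex_vector.independent_span_bound[of S B] B by blast
    moreover have "B \<noteq> {}"
      using B(3) x(1) \<open>x \<noteq> 0\<close> by auto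
    ultimately have "card B \<noteq> 0" by simp
    with B(4) show ?thesis by simp
  qed
  define s where "s i = sqrt (Re (\<alpha> i i))" for i
  have s: "0 < s i" "\<alpha> i i = of_real ((s i)\<^sup>2)" if i: "i \<in> I" for i
  proof -
    obtain x where x: "x \<in> C" "E i x \<noteq> 0" using nonzero[OF i] by blast
    have eq: "of_real ((norm (E i x))\<^sup>2) = \<alpha> i i * of_real ((norm x)\<^sup>2)"
      using \<alpha>[OF that that x(1) x(1)] by (simp only: cinner_self)
    then have "norm x \<noteq> 0" using x(2) by auto
    then have "\<alpha> i i = of_real ((norm (E i x))\<^sup>2 / (norm x)\<^sup>2)"
      using eq by (simp add: field_simps)
    moreover have "0 < (norm (E i x))\<^sup>2 / (norm x)\<^sup>2"
      using x(2) \<open>norm x \<noteq> 0\<close> by simp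
    ultimately have "0 < Re (\<alpha> i i)" "\<alpha> i i = of_real (Re (\<alpha> i i))"
      by (simp_all only: Re_complex_of_real)
    then show "0 < s i" "\<alpha> i i = of_real ((s i)\<^sup>2)"
      by (simp_all add: s_def)
  qed
  define U where "U i x = complex_of_real (1 / s i) *\<^sub>C E i x" for i x
  have U_linear: "clinear (U i)" if "i \<in> I" for i
    using bounded_clinear_imp_clinear[OF E[OF that]]
    by (simp add: Vector_Spaces.linear_iff U_def scaleC_add_right scaleC_scaleC mult.commute)
  have U_image: "U i ` C = E i ` C" if "i \<in> I" for i
  proof -
    interpret Ei: Vector_Spaces.linear scaleC scaleC "E i"
      using bounded_clinear_imp_clinear[OF E[OF that]] .
    have U_eq: "U i x = E i (complex_of_real (1 / s i) *\<^sub>C x)" for x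
      by (simp add: U_def Ei.scale)
    have E_eq: "E i x = U i (complex_of_real (s i) *\<^sub>C x)" for x
      using s(1)[OF that] by (simp add: U_def Ei.scale scaleC_scaleC scaleC_one)
    show ?thesis
    proof (intro equalityI image_subsetI)
      fix x assume "x \<in> C"
      then have "c *\<^sub>C x \<in> C" for c
        by (rule complex_vector.subspace_scale[OF sub])
      then show "U i x \<in> E i ` C" "E i x \<in> U i ` C"
        by (subst U_eq E_eq, rule imageI)+
    qed
  qed
  have U_cinner: "cinner (U i x) (U j y) = \<alpha> i j / of_real (s i * s j) * cinner x y"
    if "i \<in> I" "j \<in> I" "x \<in> C" "y \<in> C" for i j x y
    by (simp add: U_def cinner_scaleC_left cinner_scaleC_right \<alpha>[OF that])
  have U_isometry: "cinner (U i x) (U i y) = cinner x y" if "i \<in> I" "x \<in> C" "y \<in> C" for i x y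
    using U_cinner[OF that(1) that] s[OF that(1)] by (simp add: power2_eq_square)
  have pair: "proportional_isometries C (U i) (U j) (\<alpha> i j / of_real (s i * s j))"
    if "i \<in> I" "j \<in> I" for i j
    using C dim_pos[OF that(1)] U_linear[OF that(1)] U_linear[OF that(2)]
      U_isometry[OF that(1)] U_isometry[OF that(2)] U_cinner[OF that]
    by (rule proportional_isometries.intro)
  have "isoclinic (E i ` C) (E j ` C)" if "i \<in> I" "j \<in> I" for i j
    using proportional_isometries.isoclinic_images[OF pair[OF that]] U_image that by simp
  then have "pairwise isoclinic {E i ` C |i. i \<in> I}"
    by (auto simp: pairwise_def)
  moreover have "finite_dim_subspace (E i ` C) \<and> complex_vector.dim (E i ` C) = complex_vector.dim C"
    if "i \<in> I" for i
    using proportional_isometries.finite_dim_U[OF pair[OF that that]]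
      proportional_isometries.dim_U[OF pair[OF that that]] U_image[OF that] by simp
  \<comment> \<open>For \<open>I = {}\<close> the code may be trivial, so the common dimension is bounded below by \<open>max 1\<close>.\<close>
  moreover have "complex_vector.dim C = max 1 (complex_vector.dim C)" if "i \<in> I" for i
    using dim_pos[OF that] by simp
  ultimately show ?thesis
    unfolding isoclinic_collection_def by (intro conjI exI[of _ "max 1 (complex_vector.dim C)"]) auto
qed

end
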